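(* Let $n\ge 1$ and let $S,T\subseteq[n]$ with $S\le T$ in the type $C_n$ Gale order. Then \[P(\Delta[S,T])=\Big\{x\in\mathbb{R}^n \;:\; |S_{\ge i}|\le x_i+x_{i+1}+\cdots+x_n\le |T_{\ge i}| \text{ and } 0\le x_i\le 1 \text{ for all } i\in[n]\Big\}.\]
   Context: $[n]=\{1,\dots,n\}$. Type $C_n$ Gale order on subsets of $[n]$: for $A=\{a_1<\dots<a_j\}$ and $B=\{b_1<\dots<b_k\}$, $A\le B$ iff $j\le k$ and $a_{j-i+1}\le b_{k-i+1}$ for all $i\in[j]$. For $S\subseteq[n]$, $S_{\ge i}=\{s\in S: s\ge i\}$. For $S\le T$, the lattice path delta matroid $\Delta[S,T]$ is the delta matroid on $[n]$ whose feasible sets are all $R\subseteq[n]$ with $S\le R\le T$. Its feasible polytope is $P(\Delta[S,T])=\operatorname{conv}\{e_R: R \text{ feasible}\}\subseteq\mathbb{R}^n$, where $e_R=\sum_{i\in R}e_i$ and $e_1,\dots,e_n$ is the standard basis. *)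

theory Defs
  imports "HOL-Analysis.Analysis"
begin

text \<open>
  The ground set $[n]$ is an arbitrary finite linearly ordered type \<open>'n\<close> of
  cardinality $n$, so that $\mathbb{R}^n$ is \<open>real ^ 'n\<close>. Types are
  nonempty, so $n \ge 1$; every $n \ge 1$ occurs, e.g. as a numeral type.
\<close>

text \<open>
  The list \<open>sorted_list_of_set A\<close> is increasing and indexed from 0: if
  $A = \{a_1 < \dots < a_j\}$, then $a_m$ is its entry number $m - 1$, and $a_{j-i+1}$ is entry
  number $j - i$.
\<close>

definition gale_le :: "'n::{finite,linorder} set \<Rightarrow> 'n set \<Rightarrow> bool" where
  "gale_le A B \<longleftrightarrow> card A \<le> card B \<and>
     (\<forall>i\<in>{1..card A}. sorted_list_of_set A ! (card A - i) \<le> sorted_list_of_set B ! (card B - i))"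

text \<open>A delta matroid on \<open>'n\<close> is represented by its collection of feasible sets.\<close>

definition lattice_path_delta_matroid :: "'n::{finite,linorder} set \<Rightarrow> 'n set \<Rightarrow> 'n set set" where
  "lattice_path_delta_matroid S T = {R. gale_le S R \<and> gale_le R T}"

definition incidence_vector :: "'n::finite set \<Rightarrow> real ^ 'n" where
  "incidence_vector R = (\<Sum>i\<in>R. axis i 1)"

definition feasible_polytope :: "'n::finite set set \<Rightarrow> (real ^ 'n) set" where
  "feasible_polytope F = convex hull (incidence_vector ` F)"

end

theory Submission
  imports Defs
begin

text \<open>
  The Gale order compares tail counts: $A \le B$ iff $|A_{\ge i}| \le |B_{\ge i}|$ for all $i$.
  Hence the feasible sets are exactly the 0/1 points of the polytope on the right, and by
  Krein--Milman it suffices that its extreme points are integral. If some tail sum of a point $x$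
  is not an integer, move all non-integral tail sums of $x$ simultaneously by $\pm\epsilon$: the
  bounds on these sums are integers, hence strict there, and a coordinate changes only if exactly
  one of the two tail sums it separates is integral, in which case it lies strictly between 0
  and 1. So $x$ is the midpoint of a segment inside the polytope.
\<close>

text \<open>In an increasing list the entries that are at least \<open>i\<close> form a final
  segment, and \<open>card A - m\<close> is the 0-based index of the \<open>m\<close>-th largest
  entry. This translates comparisons of ranked entries into tail counts.\<close>

lemma le_sorted_list_of_set_nth_iff:
  fixes A :: "'a::linorder set"
  assumes "finite A" "1 \<le> m" "m \<le> card A"
  shows "i \<le> sorted_list_of_set A ! (card A - m) \<longleftrightarrow> m \<le> card {a \<in> A. i \<le> a}"
proof -
  define xs where "xs = sorted_list_of_set A"
  have len: "length xs = card A" and set: "set xs = A" and srt: "sorted xs" and dist: "distinct xs"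
    using assms by (auto simp: xs_def)
  define J where "J = {j. j < card A \<and> i \<le> xs ! j}"
  have img: "{a \<in> A. i \<le> a} = (!) xs ` J"
    by (auto simp: J_def len set[symmetric] in_set_conv_nth)
  have "inj_on ((!) xs) J"
    using dist by (auto simp: inj_on_def J_def len nth_eq_iff_index_eq)
  then have card: "card {a \<in> A. i \<le> a} = card J"
    by (simp add: img card_image)
  have "m \<le> card J" if "i \<le> xs ! (card A - m)"
  proof -
    have "i \<le> xs ! j" if "card A - m \<le> j" "j < card A" for j
      using sorted_nth_mono[OF srt, of "card A - m" j] \<open>i \<le> xs ! (card A - m)\<close> that len by auto
    then have "{card A - m..<card A} \<subseteq> J"
      by (auto simp: J_def)
    from card_mono[OF _ this] show ?thesis
      using assms by (simp add: J_def)
  qed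
  moreover have "card J < m" if "\<not> i \<le> xs ! (card A - m)"
  proof -
    have "card A - m < j" if "i \<le> xs ! j" "j < card A" for j
    proof (rule ccontr)
      assume "\<not> card A - m < j"
      then show False
        using sorted_nth_mono[OF srt, of j "card A - m"] \<open>\<not> i \<le> xs ! (card A - m)\<close> that len assms
        by auto
    qed
    then have "J \<subseteq> {card A - m<..<card A}"
      by (auto simp: J_def)
    from card_mono[OF _ this] show ?thesis
      using assms by simp
  qed
  ultimately show ?thesis
    unfolding card xs_def[symmetric] by (meson not_le)
qed

lemma gale_le_iff_card_tail_le:
  "gale_le A B \<longleftrightarrow> (\<forall>i. card {a \<in> A. i \<le> a} \<le> card {b \<in> B. i \<le> b})"
proof
  assume AB: "gale_le A B"
  show "\<forall>i. card {a \<in> A. i \<le> a} \<le> card {b \<in> B. i \<le> b}"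
  proof
    fix i
    \<comment> \<open>With this rank, the \<open>?m\<close>-th largest entry of \<open>A\<close> is
      at least \<open>i\<close>, hence so is that of \<open>B\<close>. Ranks start at 1, so an empty
      tail is treated apart.\<close>
    let ?m = "card {a \<in> A. i \<le> a}"
    show "?m \<le> card {b \<in> B. i \<le> b}"
    proof (cases "?m = 0")
      case False
      have mA: "?m \<le> card A"
        by (intro card_mono) auto
      with AB have mB: "?m \<le> card B"
        by (simp add: gale_le_def)
      have "i \<le> sorted_list_of_set A ! (card A - ?m)"
        using le_sorted_list_of_set_nth_iff[of A ?m i] False mA by simp
      also have "\<dots> \<le> sorted_list_of_set B ! (card B - ?m)"
        using AB False mA unfolding gale_le_def by (metis One_nat_def Suc_leI atLeastAtMost_iff neq0_conv)
      finally show ?thesis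
        using le_sorted_list_of_set_nth_iff[of B ?m i] False mB by simp
    next
      case True
      then show ?thesis
        by presburger
    qed
  qed
next
  assume tail: "\<forall>i. card {a \<in> A. i \<le> a} \<le> card {b \<in> B. i \<le> b}"
  \<comment> \<open>The tail at the least element is the whole set, which yields the comparison of
    cardinalities.\<close>
  have "{a \<in> A. Min UNIV \<le> a} = A" "{b \<in> B. Min UNIV \<le> b} = B"
    by auto
  with tail have AB: "card A \<le> card B"
    by metis
  \<comment> \<open>The threshold is the \<open>m\<close>-th largest entry of \<open>A\<close>
    itself: at least \<open>m\<close> elements of \<open>A\<close>, hence of \<open>B\<close>, reach
    it.\<close>
  moreover have "sorted_list_of_set A ! (card A - m) \<le> sorted_list_of_set B ! (card B - m)"
    if "m \<in> {1..card A}" for m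
    using le_sorted_list_of_set_nth_iff[of A m "sorted_list_of_set A ! (card A - m)"]
      le_sorted_list_of_set_nth_iff[of B m "sorted_list_of_set A ! (card A - m)"] tail that AB
    by (auto intro: order_trans)
  ultimately show "gale_le A B"
    by (simp add: gale_le_def)
qed

lemma incidence_vector_nth: "incidence_vector R $ k = (if k \<in> R then 1 else 0)"
  by (simp add: incidence_vector_def axis_def sum.delta)

lemma sum_tail_incidence_vector:
  fixes R :: "'n::{finite,linorder} set"
  shows "(\<Sum>k\<in>{i..}. incidence_vector R $ k) = real (card {r \<in> R. i \<le> r})"
proof -
  have "{i..} \<inter> R = {r \<in> R. i \<le> r}"
    by auto
  then show ?thesis
    by (simp add: incidence_vector_nth sum.If_cases)
qed

text \<open>The strict tail at \<open>k\<close> is the weak tail at the next element of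
  \<open>A\<close>, so neighbouring terms cancel; \<open>f 0\<close> comes from the empty strict
  tail at the maximum.\<close>

lemma sum_telescope_tails:
  fixes x :: "'a::linorder \<Rightarrow> 'b::comm_monoid_add" and f :: "'b \<Rightarrow> 'c::ab_group_add"
  assumes "finite A"
  shows "(\<Sum>k\<in>A. f (\<Sum>j\<in>{j \<in> A. k \<le> j}. x j) - f (\<Sum>j\<in>{j \<in> A. k < j}. x j)) =
    f (\<Sum>j\<in>A. x j) - f 0"
  using assms
proof (induction A rule: finite_linorder_min_induct)
  case (insert b A)
  have "{j \<in> insert b A. b \<le> j} = insert b A" "{j \<in> insert b A. b < j} = A"
    using insert.hyps by auto
  moreover have "{j \<in> insert b A. k \<le> j} = {j \<in> A. k \<le> j}"
    "{j \<in> insert b A. k < j} = {j \<in> A. k < j}" if "k \<in> A" for k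
    using insert.hyps that by auto
  moreover have "b \<notin> A"
    using insert.hyps by auto
  ultimately show ?case
    using insert by simp
qed simp

text \<open>A strict inequality survives small changes by continuity, and a tight one is kept
  because its slope \<open>c\<close> vanishes. The filter is two-sided, so \<open>t\<close> may have
  either sign.\<close>

lemma eventually_le_add_mult:
  fixes a y c :: real
  assumes "a \<le> y" "y = a \<Longrightarrow> c = 0"
  shows "\<forall>\<^sub>F t in at 0. a \<le> y + t * c"
proof (cases "y = a")
  case False
  have "((\<lambda>t. y + t * c) \<longlongrightarrow> y + 0 * c) (at 0)"
    by (intro tendsto_intros)
  then have "\<forall>\<^sub>F t in at 0. a < y + t * c"
    using assms(1) False by (intro order_tendstoD(1)) auto
  then show ?thesis
    by eventually_elim simp
qed (use assms in simp)

lemma extreme_point_ofD_add_diff: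
  fixes x :: "'a::real_vector"
  assumes "x extreme_point_of P" "x + d \<in> P" "x - d \<in> P"
  shows "d = 0"
proof (rule ccontr)
  assume "d \<noteq> 0"
  moreover have "(x + d) - (x - d) = 2 *\<^sub>R d"
    by (simp add: scaleR_2)
  ultimately have "x + d \<noteq> x - d"
    by (metis eq_iff_diff_eq_0 scaleR_eq_0_iff zero_neq_numeral)
  moreover have "x = midpoint (x + d) (x - d)"
    by (simp add: midpoint_def scaleR_2[symmetric])
  ultimately have "x \<in> open_segment (x + d) (x - d)"
    by (metis midpoint_in_open_segment)
  with assms show False
    by (auto simp: extreme_point_of_def)
qed

definition tail_polytope :: "('n::{finite,linorder} \<Rightarrow> real) \<Rightarrow> ('n \<Rightarrow> real) \<Rightarrow> (real, 'n) vec set" where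
  "tail_polytope a b =
    {x. \<forall>i. a i \<le> (\<Sum>k\<in>{i..}. x $ k) \<and> (\<Sum>k\<in>{i..}. x $ k) \<le> b i \<and> 0 \<le> x $ i \<and> x $ i \<le> 1}"

text \<open>As an intersection of preimages of closed intervals under linear maps, the set is
  visibly convex and closed.\<close>

lemma tail_polytope_eq_INT_vimage:
  "tail_polytope a b =
    (\<Inter>i. (\<lambda>x. \<Sum>k\<in>{i..}. x $ k) -` {a i..b i} \<inter> (\<lambda>x. x $ i) -` {0..1})"
  by (auto simp: tail_polytope_def)

lemma convex_tail_polytope: "convex (tail_polytope a b)"
  unfolding tail_polytope_eq_INT_vimage
  by (intro convex_INT convex_Int convex_linear_vimage)
    (auto intro!: linearI simp: sum.distrib sum_distrib_left)

lemma compact_tail_polytope: "compact (tail_polytope a b)"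
proof -
  have "closed (tail_polytope a b)"
    unfolding tail_polytope_eq_INT_vimage
    by (intro closed_INT ballI closed_Int closed_vimage) (auto intro!: continuous_intros)
  moreover have "tail_polytope a b \<subseteq> cbox 0 1"
    by (auto simp: tail_polytope_def mem_box_cart)
  ultimately show ?thesis
    by (meson bounded_cbox bounded_subset compact_eq_bounded_closed)
qed

lemma extreme_point_of_tail_polytope_Ints:
  fixes a b :: "'n::{finite,linorder} \<Rightarrow> real"
  assumes a: "\<And>i. a i \<in> \<int>" and b: "\<And>i. b i \<in> \<int>"
    and x: "x extreme_point_of tail_polytope a b"
  shows "x $ i \<in> \<int>"
proof -
  \<comment> \<open>\<open>f\<close> indicates non-integrality. The direction \<open>d\<close> below
    is built so that its tail sum at \<open>i\<close> is \<open>f (F i)\<close>: moving along it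
    shifts exactly the non-integral tail sums, all at the same rate.\<close>
  define f :: "real \<Rightarrow> real" where "f y = (if y \<in> \<int> then 0 else 1)" for y
  define F where "F i = (\<Sum>k\<in>{i..}. x $ k)" for i
  define G where "G i = (\<Sum>k\<in>{i<..}. x $ k)" for i
  define d where "d = (\<chi> k::'n. f (F k) - f (G k))"
  have xP: "x \<in> tail_polytope a b"
    using x by (simp add: extreme_point_of_def)
  have F_eq: "F i = x $ i + G i" for i
  proof -
    have "{i..} = insert i {i<..}"
      by auto
    then show ?thesis
      by (simp add: F_def G_def)
  qed
  \<comment> \<open>Tails taken inside a tail are tails of the whole type, so the telescoping lemma
    applies; its last term disappears since \<open>f 0 = 0\<close>.\<close>
  have "{j \<in> {i..}. k \<le> j} = {k..}" "{j \<in> {i..}. k < j} = {k<..}" if "i \<le> k" for i k :: 'n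
    using that by auto
  then have sum_d: "(\<Sum>k\<in>{i..}. d $ k) = f (F i)" for i
    using sum_telescope_tails[of "{i..}" f "\<lambda>j. x $ j"] by (simp add: d_def F_def G_def f_def)
  have "{j \<in> {i<..}. k \<le> j} = {k..}" "{j \<in> {i<..}. k < j} = {k<..}" if "i < k" for i k :: 'n
    using that by auto
  then have sum_d': "(\<Sum>k\<in>{i<..}. d $ k) = f (G i)" for i
    using sum_telescope_tails[of "{i<..}" f "\<lambda>j. x $ j"] by (simp add: d_def F_def G_def f_def)
  \<comment> \<open>If \<open>x $ i\<close> is an integer, then \<open>F i\<close> and
    \<open>G i\<close> are both integral or both non-integral. In particular, coordinates equal to 0
    or 1 do not move.\<close>
  have d_0: "d $ i = 0" if "x $ i \<in> \<int>" for i
    using that by (auto simp: d_def f_def F_eq)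
  have mem: "\<forall>\<^sub>F t in at 0. x + t *\<^sub>R (s *\<^sub>R d) \<in> tail_polytope a b" for s
  proof -
    \<comment> \<open>Upper bounds are negated to fit the lemma on lower bounds. A tight tail bound
      makes \<open>F i\<close> an integer, so its slope is 0.\<close>
    have "\<forall>\<^sub>F t in at 0. a i \<le> F i + t * (s * f (F i)) \<and> - b i \<le> - F i + t * (- (s * f (F i))) \<and>
        0 \<le> x $ i + t * (s * d $ i) \<and> - 1 \<le> - x $ i + t * (- (s * d $ i))" for i
      using xP a[of i] b[of i] d_0[of i]
      by (intro eventually_conj eventually_le_add_mult) (auto simp: tail_polytope_def F_def f_def)
    then have "\<forall>\<^sub>F t in at 0. \<forall>i. a i \<le> F i + t * (s * f (F i)) \<and>
        - b i \<le> - F i + t * (- (s * f (F i))) \<and>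
        0 \<le> x $ i + t * (s * d $ i) \<and> - 1 \<le> - x $ i + t * (- (s * d $ i))"
      by (rule eventually_all_finite)
    then show ?thesis
    proof eventually_elim
      case (elim t)
      have "(\<Sum>k\<in>{i..}. (x + t *\<^sub>R (s *\<^sub>R d)) $ k) = F i + t * (s * f (F i))" for i
        by (simp add: sum.distrib sum_d flip: sum_distrib_left F_def)
      with elim show ?case
        by (simp add: tail_polytope_def algebra_simps)
    qed
  qed
  \<comment> \<open>A nonzero \<open>t\<close> is required in order to pass from
    \<open>t *\<^sub>R d = 0\<close> to \<open>d = 0\<close>.\<close>
  have "\<forall>\<^sub>F t::real in at 0. t \<noteq> 0"
    by (simp add: eventually_at_filter)
  with mem[of 1] mem[of "-1"]
  have "\<forall>\<^sub>F t in at 0. t \<noteq> 0 \<and> x + t *\<^sub>R d \<in> tail_polytope a b \<and> x - t *\<^sub>R d \<in> tail_polytope a b"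
    by eventually_elim simp
  then obtain t where "t \<noteq> 0" "x + t *\<^sub>R d \<in> tail_polytope a b" "x - t *\<^sub>R d \<in> tail_polytope a b"
    using eventually_happens[of _ "at (0::real)"] by auto
  with extreme_point_ofD_add_diff[OF x, of "t *\<^sub>R d"] have "d = 0"
    by simp
  \<comment> \<open>Since \<open>d\<close> vanishes, so do its tail sums \<open>f (F i)\<close> and
    \<open>f (G i)\<close>; hence \<open>x $ i\<close> is a difference of two integers.\<close>
  with sum_d[of i] sum_d'[of i] have "F i \<in> \<int>" "G i \<in> \<int>"
    by (auto simp: f_def split: if_splits)
  with F_eq[of i] show ?thesis
    by (metis Ints_diff add_diff_cancel_right')
qed

theorem theorem4p2:
  fixes S T :: "'n::{finite,linorder} set"
  assumes "gale_le S T"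
  shows "feasible_polytope (lattice_path_delta_matroid S T) =
    {x. \<forall>i.
       real (card {s \<in> S. i \<le> s}) \<le> (\<Sum>k\<in>{i..}. x $ k) \<and>
       (\<Sum>k\<in>{i..}. x $ k) \<le> real (card {t \<in> T. i \<le> t}) \<and>
       0 \<le> x $ i \<and> x $ i \<le> 1}"
proof -
  let ?P = "tail_polytope (\<lambda>i. real (card {s \<in> S. i \<le> s})) (\<lambda>i. real (card {t \<in> T. i \<le> t}))"
  have vertex_iff: "incidence_vector R \<in> ?P \<longleftrightarrow> R \<in> lattice_path_delta_matroid S T" for R
  proof -
    have "0 \<le> incidence_vector R $ i \<and> incidence_vector R $ i \<le> 1" for i
      by (simp add: incidence_vector_nth)
    then show ?thesis
      by (auto simp: tail_polytope_def sum_tail_incidence_vector lattice_path_delta_matroid_def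
          gale_le_iff_card_tail_le)
  qed
  have extreme: "x \<in> incidence_vector ` lattice_path_delta_matroid S T"
    if x: "x extreme_point_of ?P" for x
  proof -
    have xP: "x \<in> ?P"
      using x by (simp add: extreme_point_of_def)
    have "x $ i = 0 \<or> x $ i = 1" for i
    proof -
      have "x $ i \<in> \<int>"
        by (rule extreme_point_of_tail_polytope_Ints[OF _ _ x]) auto
      then obtain z :: int where "x $ i = of_int z"
        by (elim Ints_cases)
      moreover have "0 \<le> x $ i" "x $ i \<le> 1"
        using xP by (auto simp: tail_polytope_def)
      ultimately show ?thesis
        by auto
    qed
    \<comment> \<open>A 0/1 point is the incidence vector of its support, and that support is
      feasible by \<open>vertex_iff\<close>.\<close>
    then have "incidence_vector {i. x $ i = 1} = x"
      by (auto simp: vec_eq_iff incidence_vector_nth)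
    then obtain R where "x = incidence_vector R"
      by metis
    with xP vertex_iff show ?thesis
      by blast
  qed
  have "convex hull (incidence_vector ` lattice_path_delta_matroid S T) \<subseteq> ?P"
    using vertex_iff by (intro hull_minimal convex_tail_polytope) auto
  moreover have "?P = convex hull {x. x extreme_point_of ?P}"
    by (intro Krein_Milman_Minkowski compact_tail_polytope convex_tail_polytope)
  moreover have "convex hull {x. x extreme_point_of ?P}
      \<subseteq> convex hull (incidence_vector ` lattice_path_delta_matroid S T)"
    using extreme by (intro hull_mono) auto
  ultimately have "convex hull (incidence_vector ` lattice_path_delta_matroid S T) = ?P"
    by blast
  then show ?thesis
    by (simp add: feasible_polytope_def tail_polytope_def)
qed

end
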